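(* Let $n\ge 1$, let $a_1,a_2,\dots,a_n$ be distinct integers, and let $\mathcal{M}$ be a set of integers with $|\mathcal{M}|\le\left\lfloor\frac{n}{2}\right\rfloor$. Then there exists a permutation $(b_1,\dots,b_n)$ of the sequence $(a_1,\dots,a_n)$ such that none of the sums $b_1,\ b_1+b_2,\ \dots,\ b_1+b_2+\dots+b_{n-1}$ is an element of $\mathcal{M}$. Moreover, if the numbers $a_1,a_2,\dots,a_n$ are all nonzero, then the same conclusion holds under the weaker assumption $|\mathcal{M}|\le\left\lfloor\frac{n+1}{2}\right\rfloor$. *)

theory Defs
  imports Complex_Main "HOL-Combinatorics.Permutations"
begin

end

theory Submission
  imports Defs "HOL-Library.Function_Algebras" "Jordan_Normal_Form.Determinant"
begin

text \<open>
  If every order \<open>\<sigma>\<close> of the jumps hits \<open>M\<close>, then the product of all \<open>\<mu> - S\<^sub>k(\<sigma>)\<close> with \<open>\<mu> \<in> M\<close> and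
  \<open>S\<^sub>k(\<sigma>)\<close> the \<open>k\<close>-th partial sum is zero for every \<open>\<sigma>\<close>, hence so is its signed sum over \<open>\<sigma>\<close>.  For \<open>n = 2m\<close>
  and \<open>m\<close> forbidden values there are \<open>n(n-1)/2\<close> factors, so the signed sum is an alternating polynomial
  of that degree in the jumps, hence \<open>c\<close> times their Vandermonde product, and the \<open>\<mu>\<close> do not matter.
  It remains to see that \<open>c \<noteq> 0\<close>.

  The signed sum of \<open>\<langle>x, a\<^sub>\<sigma>\<rangle>\<^sup>N\<close> is a positive multiple of \<open>V(a) V(x)\<close> for \<open>N = n(n-1)/2\<close> and zero for
  smaller \<open>N\<close>.  Taking iterated differences in \<open>x\<close> along the vectors \<open>v\<^sub>k = -(1,\<dots>,1,0,\<dots>,0)\<close> polarizes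
  the powers into products of the \<open>-S\<^sub>k\<close>, so \<open>c\<close> is up to a positive factor the iterated difference of
  \<open>V(x)\<close>, the product of the \<open>x\<^sub>j - x\<^sub>i\<close> with \<open>i < j\<close>.  Each of these linear forms is nonnegative at every
  \<open>v\<^sub>k\<close>, and positive exactly if \<open>i < k \<le> j\<close>; so \<open>c > 0\<close> follows from an assignment of a \<open>k\<close> with
  \<open>i < k \<le> j\<close> to each pair that uses every \<open>k\<close> exactly \<open>m\<close> times.

  For odd \<open>n\<close>, choose the last jump such that the sum of the others avoids \<open>M\<close>; if no jump is zero, add
  the jump \<open>0\<close> first and delete it afterwards.
\<close>

section \<open>Iterated differences of products of linear forms\<close>

fun iter_diff :: "'v::plus list \<Rightarrow> ('v \<Rightarrow> 'b::comm_ring_1) \<Rightarrow> 'v \<Rightarrow> 'b" where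
  "iter_diff [] f = f"
| "iter_diff (v # vs) f = iter_diff vs (\<lambda>x. f (x + v) - f x)"

lemma iter_diff_sum:
  "iter_diff vs (\<lambda>x. \<Sum>s\<in>S. c s * g s x) = (\<lambda>x. \<Sum>s\<in>S. c s * iter_diff vs (g s) x)"
proof (induction vs arbitrary: g)
  case (Cons v vs)
  have "(\<lambda>x. (\<Sum>s\<in>S. c s * g s (x + v)) - (\<Sum>s\<in>S. c s * g s x))
      = (\<lambda>x. \<Sum>s\<in>S. c s * (g s (x + v) - g s x))"
    by (simp add: sum_subtractf right_diff_distrib)
  then show ?case
    using Cons.IH[of "\<lambda>s x. g s (x + v) - g s x"] by simp
qed simp

lemma iter_diff_scale: "iter_diff vs (\<lambda>x. c * g x) = (\<lambda>x. c * iter_diff vs g x)"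
  using iter_diff_sum[of vs "\<lambda>_. c" "\<lambda>_. g" "{()}"] by simp

lemma iter_diff_zero: "iter_diff vs (\<lambda>x. 0) = (\<lambda>x. 0)"
  using iter_diff_scale[of vs 0 "\<lambda>x. 0"] by simp

text \<open>Expanding the product of the \<open>l s v + l s x\<close> over subsets, \<open>A\<close>
  collects the factors evaluated at \<open>v\<close>; the term of the empty \<open>A\<close>
  cancels. So a difference always costs at least one factor.\<close>

lemma iter_diff_Cons_prod:
  fixes l :: "'s \<Rightarrow> 'v::plus \<Rightarrow> 'b::comm_ring_1"
  assumes S: "finite S" and add: "\<And>s x y. s \<in> S \<Longrightarrow> l s (x + y) = l s x + l s y"
  shows "iter_diff (v # vs) (\<lambda>x. \<Prod>s\<in>S. l s x)
    = (\<lambda>x. \<Sum>A \<in> Pow S - {{}}. (\<Prod>s\<in>A. l s v) * iter_diff vs (\<lambda>x. \<Prod>s\<in>S - A. l s x) x)"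
proof -
  have "(\<Prod>s\<in>S. l s (x + v)) - (\<Prod>s\<in>S. l s x)
      = (\<Sum>A \<in> Pow S - {{}}. (\<Prod>s\<in>A. l s v) * (\<Prod>s\<in>S - A. l s x))" for x
  proof -
    have "(\<Prod>s\<in>S. l s (x + v)) = (\<Prod>s\<in>S. l s v + l s x)"
      by (intro prod.cong) (auto simp: add add.commute)
    also have "\<dots> = (\<Sum>A \<in> Pow S. (\<Prod>s\<in>A. l s v) * (\<Prod>s\<in>S - A. l s x))"
      by (rule prod_add[OF S])
    also have "\<dots> = (\<Prod>s\<in>S. l s x) + (\<Sum>A \<in> Pow S - {{}}. (\<Prod>s\<in>A. l s v) * (\<Prod>s\<in>S - A. l s x))"
      by (subst sum.remove[of "Pow S" "{}"]) (use S in auto)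
    finally show ?thesis by simp
  qed
  then have "iter_diff (v # vs) (\<lambda>x. \<Prod>s\<in>S. l s x)
    = iter_diff vs (\<lambda>x. \<Sum>A \<in> Pow S - {{}}. (\<Prod>s\<in>A. l s v) * (\<Prod>s\<in>S - A. l s x))"
    by simp
  then show ?thesis by (simp only: iter_diff_sum)
qed

lemma iter_diff_prod_eq_0:
  fixes l :: "'s \<Rightarrow> 'v::plus \<Rightarrow> 'b::comm_ring_1"
  assumes "finite S" and "\<And>s x y. s \<in> S \<Longrightarrow> l s (x + y) = l s x + l s y"
    and "card S < length vs"
  shows "iter_diff vs (\<lambda>x. \<Prod>s\<in>S. l s x) = (\<lambda>x. 0)"
  using assms
proof (induction vs arbitrary: S)
  case (Cons v vs)
  have "iter_diff vs (\<lambda>x. \<Prod>s\<in>S - A. l s x) = (\<lambda>x. 0)" if "A \<in> Pow S - {{}}" for A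
  proof -
    have "card (S - A) < card S"
      using that Cons.prems(1) by (intro psubset_card_mono) auto
    with Cons show ?thesis by (intro Cons.IH) auto
  qed
  then show ?case
    by (subst iter_diff_Cons_prod) (use Cons.prems in auto)
qed simp

text \<open>With as many differences as factors, fixing two or more factors at \<open>v\<close>
  leaves too few for the remaining differences, so only singletons \<open>A\<close> survive.\<close>

lemma iter_diff_Cons_prod_top:
  fixes l :: "'s \<Rightarrow> 'v::plus \<Rightarrow> 'b::comm_ring_1"
  assumes S: "finite S" and add: "\<And>s x y. s \<in> S \<Longrightarrow> l s (x + y) = l s x + l s y"
    and card: "card S = Suc (length vs)"
  shows "iter_diff (v # vs) (\<lambda>x. \<Prod>s\<in>S. l s x)
    = (\<lambda>x. \<Sum>t\<in>S. l t v * iter_diff vs (\<lambda>x. \<Prod>s\<in>S - {t}. l s x) x)"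
proof
  fix x
  let ?h = "\<lambda>A. (\<Prod>s\<in>A. l s v) * iter_diff vs (\<lambda>x. \<Prod>s\<in>S - A. l s x) x"
  have "iter_diff (v # vs) (\<lambda>x. \<Prod>s\<in>S. l s x) x = (\<Sum>A \<in> Pow S - {{}}. ?h A)"
    by (simp only: iter_diff_Cons_prod[OF S add])
  also have "\<dots> = (\<Sum>A \<in> (\<lambda>t. {t}) ` S. ?h A)"
  proof (intro sum.mono_neutral_right ballI)
    fix A assume A: "A \<in> Pow S - {{}} - (\<lambda>t. {t}) ` S"
    then have "finite A" "A \<subseteq> S" "A \<noteq> {}" using S finite_subset by auto
    moreover have "card A \<noteq> 1" using A by (auto simp: card_1_singleton_iff)
    ultimately have "2 \<le> card A"
      by (metis One_nat_def Suc_1 Suc_leI card_gt_0_iff le_neq_implies_less)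
    moreover have "card A \<le> card S" using \<open>A \<subseteq> S\<close> S by (rule card_mono[rotated])
    ultimately have "card (S - A) < length vs"
      using card \<open>finite A\<close> \<open>A \<subseteq> S\<close> by (simp add: card_Diff_subset)
    then show "?h A = 0"
      using S add by (subst iter_diff_prod_eq_0) auto
  qed (use S in auto)
  also have "\<dots> = (\<Sum>t\<in>S. l t v * iter_diff vs (\<lambda>x. \<Prod>s\<in>S - {t}. l s x) x)"
    by (subst sum.reindex) auto
  finally show "iter_diff (v # vs) (\<lambda>x. \<Prod>s\<in>S. l s x) x = \<dots>" .
qed

text \<open>Polarization: the power is a product of equal factors, and any factor still left may be
  the one evaluated at the next vector, which gives the factorial.\<close>

lemma iter_diff_power:
  fixes l :: "'v::plus \<Rightarrow> 'b::comm_ring_1"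
  assumes add: "\<And>x y. l (x + y) = l x + l y"
  shows "iter_diff vs (\<lambda>x. l x ^ length vs) x = of_nat (fact (length vs)) * (\<Prod>v\<leftarrow>vs. l v)"
proof (induction vs)
  case (Cons v vs)
  let ?S = "{..<Suc (length vs)}"
  have "iter_diff (v # vs) (\<lambda>x. l x ^ length (v # vs)) x
      = iter_diff (v # vs) (\<lambda>x. \<Prod>s\<in>?S. l x) x"
    by (simp only: prod_constant card_lessThan list.size add_Suc_right add_0_right)
  also have "\<dots> = (\<Sum>t\<in>?S. l v * iter_diff vs (\<lambda>x. \<Prod>s\<in>?S - {t}. l x) x)"
    by (subst iter_diff_Cons_prod_top) (simp_all add: add)
  also have "\<dots> = (\<Sum>t\<in>?S. l v * iter_diff vs (\<lambda>x. l x ^ length vs) x)"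
    by (intro sum.cong) simp_all
  also have "\<dots> = of_nat (fact (length (v # vs))) * (\<Prod>v\<leftarrow>v # vs. l v)"
    by (simp add: Cons.IH algebra_simps)
  finally show ?case .
qed simp

text \<open>By repeated use of the top-degree formula the iterated difference is the permanent of
  the matrix of all \<open>l s v\<close>, here with nonnegative entries.\<close>

lemma iter_diff_prod_nonneg:
  fixes l :: "'s \<Rightarrow> 'v::plus \<Rightarrow> 'b::linordered_idom"
  assumes "finite S" and "\<And>s x y. s \<in> S \<Longrightarrow> l s (x + y) = l s x + l s y"
    and "card S = length vs" and "\<And>s v. s \<in> S \<Longrightarrow> v \<in> set vs \<Longrightarrow> 0 \<le> l s v"
  shows "0 \<le> iter_diff vs (\<lambda>x. \<Prod>s\<in>S. l s x) x"
  using assms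
proof (induction vs arbitrary: S)
  case (Cons v vs)
  have "iter_diff (v # vs) (\<lambda>x. \<Prod>s\<in>S. l s x) x
      = (\<Sum>t\<in>S. l t v * iter_diff vs (\<lambda>x. \<Prod>s\<in>S - {t}. l s x) x)"
    by (subst iter_diff_Cons_prod_top) (use Cons.prems in auto)
  also have "0 \<le> \<dots>"
    using Cons.prems by (intro sum_nonneg mult_nonneg_nonneg Cons.IH) auto
  finally show ?case .
qed simp

text \<open>In this permanent the diagonal term, which evaluates each \<open>l s\<close> at its own
  vector \<open>w s\<close>, is positive and no other term is negative.\<close>

lemma iter_diff_prod_pos:
  fixes l :: "'s \<Rightarrow> 'v::plus \<Rightarrow> 'b::linordered_idom"
  assumes "distinct ss" and "\<And>s x y. s \<in> set ss \<Longrightarrow> l s (x + y) = l s x + l s y"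
    and "\<And>s t. s \<in> set ss \<Longrightarrow> t \<in> set ss \<Longrightarrow> 0 \<le> l s (w t)"
    and "\<And>s. s \<in> set ss \<Longrightarrow> 0 < l s (w s)"
  shows "0 < iter_diff (map w ss) (\<lambda>x. \<Prod>s\<in>set ss. l s x) x"
  using assms
proof (induction ss)
  case (Cons r ss)
  have r: "set (r # ss) - {r} = set ss" using Cons.prems(1) by auto
  have "iter_diff (map w (r # ss)) (\<lambda>x. \<Prod>s\<in>set (r # ss). l s x) x
      = (\<Sum>t\<in>set (r # ss). l t (w r) * iter_diff (map w ss) (\<lambda>x. \<Prod>s\<in>set (r # ss) - {t}. l s x) x)"
    unfolding list.map
    by (subst iter_diff_Cons_prod_top) (use Cons.prems in \<open>auto simp: distinct_card\<close>)
  also have "\<dots> > 0"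
  proof (rule sum_pos2[of _ r])
    show "0 < l r (w r) * iter_diff (map w ss) (\<lambda>x. \<Prod>s\<in>set (r # ss) - {r}. l s x) x"
      unfolding r using Cons by (intro mult_pos_pos Cons.IH) auto
    show "0 \<le> l t (w r) * iter_diff (map w ss) (\<lambda>x. \<Prod>s\<in>set (r # ss) - {t}. l s x) x"
      if "t \<in> set (r # ss)" for t
      using Cons.prems that distinct_card[of "r # ss"]
      by (intro mult_nonneg_nonneg iter_diff_prod_nonneg) auto
  qed auto
  finally show ?case .
qed simp

section \<open>Alternating power sums\<close>

lemma det_vandermonde:
  fixes x :: "nat \<Rightarrow> 'a::idom"
  shows "det (mat n n (\<lambda>(i, j). x i ^ j)) = (\<Prod>(j, i) \<in> (SIGMA j:{0..<n}. {0..<j}). x j - x i)"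
proof -
  define p where "p j = (\<Prod>k\<in>{0..<j}. [:- x k, 1:])" for j
  define U where "U = mat n n (\<lambda>(k, j). coeff (p j) k)"
  let ?X = "mat n n (\<lambda>(i, j). x i ^ j)"
  \<comment> \<open>Right multiplication by the unitriangular \<open>U\<close> makes \<open>?X\<close> lower triangular,
    as \<open>p j\<close> vanishes at \<open>x 0, \<dots>, x (j - 1)\<close>.\<close>
  have deg: "degree (p j) = j" for j
    unfolding p_def by (subst degree_prod_eq_sum_degree) auto
  have monic: "coeff (p j) j = 1" for j
    using lead_coeff_prod[of "\<lambda>k. [:- x k, 1:]" "{0..<j}"] deg[of j] by (simp add: p_def)
  have prod: "?X * U = mat n n (\<lambda>(i, j). poly (p j) (x i))"
  proof (rule eq_matI)
    fix i j assume "i < dim_row (mat n n (\<lambda>(i, j). poly (p j) (x i)))"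
      and "j < dim_col (mat n n (\<lambda>(i, j). poly (p j) (x i)))"
    then have ij: "i < n" "j < n" by auto
    have "poly (p j) (x i) = (\<Sum>k\<le>j. coeff (p j) k * x i ^ k)"
      using deg[of j] by (simp add: poly_altdef)
    also have "\<dots> = (\<Sum>k\<in>{0..<n}. coeff (p j) k * x i ^ k)"
      using ij deg[of j] by (intro sum.mono_neutral_left) (auto simp: coeff_eq_0)
    finally show "(?X * U) $$ (i, j) = mat n n (\<lambda>(i, j). poly (p j) (x i)) $$ (i, j)"
      using ij by (simp add: U_def scalar_prod_def mult.commute)
  qed (auto simp: U_def)
  have "det U = prod_list (diag_mat U)"
    by (rule det_upper_triangular[of _ n])
       (auto simp: U_def upper_triangular_def coeff_eq_0 deg)
  also have "diag_mat U = map (\<lambda>_. 1) [0..<n]"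
    by (auto simp: diag_mat_def U_def monic)
  also have "prod_list \<dots> = 1" by (induction n) auto
  finally have "det U = 1" .
  then have "det ?X = det (?X * U)"
    by (subst det_mult[of _ n]) (auto simp: U_def)
  also have "\<dots> = prod_list (diag_mat (mat n n (\<lambda>(i, j). poly (p j) (x i))))"
    unfolding prod by (rule det_lower_triangular[of n]) (auto simp: p_def poly_prod)
  also have "\<dots> = prod_list (map (\<lambda>i. poly (p i) (x i)) [0..<n])"
    by (auto simp: diag_mat_def intro!: arg_cong[of _ _ prod_list])
  also have "\<dots> = (\<Prod>i\<in>{0..<n}. poly (p i) (x i))"
    by (subst prod.distinct_set_conv_list[symmetric]) auto
  also have "\<dots> = (\<Prod>j\<in>{0..<n}. \<Prod>i\<in>{0..<j}. x j - x i)"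
    by (simp add: p_def poly_prod)
  also have "\<dots> = (\<Prod>(j, i) \<in> (SIGMA j:{0..<n}. {0..<j}). x j - x i)"
    by (rule prod.Sigma) auto
  finally show ?thesis .
qed

text \<open>Induction by removing the maximum: among \<open>Suc n\<close> distinct naturals it is at
  least \<open>n\<close>, with equality in the sum only if it equals \<open>n\<close>.\<close>

lemma sum_initial_segment_le:
  fixes D :: "nat set"
  assumes "finite D"
  shows "\<Sum>{0..<card D} \<le> \<Sum>D" and "\<Sum>D = \<Sum>{0..<card D} \<Longrightarrow> D = {0..<card D}"
proof -
  have "\<Sum>{0..<n} \<le> \<Sum>D \<and> (\<Sum>D = \<Sum>{0..<n} \<longrightarrow> D = {0..<n})"
    if "finite D" "card D = n" for n and D :: "nat set"
    using that
  proof (induction n arbitrary: D)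
    case (Suc n)
    let ?M = "Max D"
    have M: "?M \<in> D" using Suc.prems by (intro Max_in) auto
    have "D \<subseteq> {0..?M}" using Suc.prems by auto
    from card_mono[OF _ this] have n: "n \<le> ?M" using Suc.prems by simp
    have IH: "\<Sum>{0..<n} \<le> \<Sum>(D - {?M})" "\<Sum>(D - {?M}) = \<Sum>{0..<n} \<longrightarrow> D - {?M} = {0..<n}"
      using Suc.IH[of "D - {?M}"] Suc.prems M by auto
    have D: "\<Sum>D = ?M + \<Sum>(D - {?M})" using M Suc.prems by (simp add: sum.remove)
    have "D = {0..<Suc n}" if "\<Sum>D = \<Sum>{0..<Suc n}"
    proof -
      from that D n IH(1) have "?M = n" "\<Sum>(D - {?M}) = \<Sum>{0..<n}" by auto
      with IH(2) have "D - {?M} = {0..<n}" by simp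
      with M \<open>?M = n\<close> show ?thesis by (auto simp: atLeast0_lessThan_Suc)
    qed
    with D n IH(1) show ?case by auto
  qed simp
  from this[OF assms refl] show "\<Sum>{0..<card D} \<le> \<Sum>D"
    and "\<Sum>D = \<Sum>{0..<card D} \<Longrightarrow> D = {0..<card D}" by auto
qed

lemma det_generalized_vandermonde_eq_0:
  assumes "\<not> inj_on d {0..<n}"
  shows "det (mat n n (\<lambda>(i, j). a j ^ d i)) = (0 :: 'a::comm_ring_1)"
proof -
  obtain i j where "i < n" "j < n" "i \<noteq> j" "d i = d j"
    using assms by (auto simp: inj_on_def)
  then show ?thesis
    by (intro det_identical_rows[of _ n i j]) (auto intro!: eq_vecI)
qed

lemma alternating_sum_eq_det:
  fixes a :: "nat \<Rightarrow> int"
  shows "(\<Sum>\<sigma> | \<sigma> permutes {0..<n}. sign \<sigma> * (\<Prod>i\<in>{0..<n}. a (\<sigma> i) ^ d i))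
    = det (mat n n (\<lambda>(i, j). a j ^ d i))"
  by (subst det_def'[of _ n]) (auto intro!: sum.cong prod.cong simp: permutes_in_image[of _ "{0..<n}", simplified])

lemma det_vandermonde_transposed:
  fixes x :: "nat \<Rightarrow> int"
  shows "det (mat n n (\<lambda>(i, j). x j ^ i)) = (\<Prod>(j, i) \<in> (SIGMA j:{0..<n}. {0..<j}). x j - x i)"
proof -
  have "det (mat n n (\<lambda>(i, j). x j ^ i)) = det (transpose_mat (mat n n (\<lambda>(i, j). x i ^ j)))"
    by (rule arg_cong[of _ _ det]) (auto intro!: eq_matI)
  also have "\<dots> = det (mat n n (\<lambda>(i, j). x i ^ j))"
    by (rule det_transpose[of _ n]) auto
  finally show ?thesis by (simp add: det_vandermonde)
qed

section \<open>Expansion of the alternating power sum\<close>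

text \<open>A map \<open>f\<close> records which summand is chosen from each of the \<open>N\<close>
  factors of a power; this is the exponent of the \<open>i\<close>-th variable in the resulting
  monomial.\<close>

definition fibre_card :: "nat \<Rightarrow> (nat \<Rightarrow> nat) \<Rightarrow> nat \<Rightarrow> nat" where
  "fibre_card N f i = card {r \<in> {0..<N}. f r = i}"

lemma sum_fibre_card:
  assumes "f \<in> {0..<N} \<rightarrow>\<^sub>E {0..<n}"
  shows "(\<Sum>i\<in>{0..<n}. fibre_card N f i) = N"
proof -
  have "f ` {0..<N} \<subseteq> {0..<n}" using assms by auto
  then show ?thesis
    using sum.group[of "{0..<N}" "{0..<n}" f "\<lambda>_. 1::nat"] by (simp add: fibre_card_def)
qed

lemma prod_eq_prod_power_fibre_card:
  fixes g :: "nat \<Rightarrow> 'a::comm_monoid_mult"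
  assumes "f \<in> {0..<N} \<rightarrow>\<^sub>E {0..<n}"
  shows "(\<Prod>r\<in>{0..<N}. g (f r)) = (\<Prod>i\<in>{0..<n}. g i ^ fibre_card N f i)"
proof -
  have "(\<Prod>r\<in>{0..<N}. g (f r)) = (\<Prod>i\<in>{0..<n}. \<Prod>r | r \<in> {0..<N} \<and> f r = i. g (f r))"
    using assms by (intro prod.group[symmetric]) auto
  also have "\<dots> = (\<Prod>i\<in>{0..<n}. \<Prod>r | r \<in> {0..<N} \<and> f r = i. g i)"
    by (intro prod.cong) auto
  finally show ?thesis by (simp add: fibre_card_def)
qed

text \<open>Equal monomials are left uncollected, so no multinomial coefficients appear; for each
  \<open>f\<close> the signed sum over \<sigma> is a Leibniz expansion.\<close>

lemma alternating_power_sum_expand: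
  fixes a x :: "nat \<Rightarrow> int"
  shows "(\<Sum>\<sigma> | \<sigma> permutes {0..<n}. sign \<sigma> * (\<Sum>i\<in>{0..<n}. x i * a (\<sigma> i)) ^ N)
    = (\<Sum>f \<in> {0..<N} \<rightarrow>\<^sub>E {0..<n}. (\<Prod>i\<in>{0..<n}. x i ^ fibre_card N f i)
        * det (mat n n (\<lambda>(i, j). a j ^ fibre_card N f i)))"
proof -
  let ?F = "{0..<N} \<rightarrow>\<^sub>E {0..<n}"
  have "(\<Sum>i\<in>{0..<n}. x i * a (\<sigma> i)) ^ N
      = (\<Sum>f\<in>?F. (\<Prod>i\<in>{0..<n}. x i ^ fibre_card N f i) * (\<Prod>i\<in>{0..<n}. a (\<sigma> i) ^ fibre_card N f i))"
    for \<sigma>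
  proof -
    have "(\<Sum>i\<in>{0..<n}. x i * a (\<sigma> i)) ^ N = (\<Prod>r\<in>{0..<N}. \<Sum>i\<in>{0..<n}. x i * a (\<sigma> i))"
      by simp
    also have "\<dots> = (\<Sum>f\<in>?F. \<Prod>r\<in>{0..<N}. x (f r) * a (\<sigma> (f r)))"
      by (rule prod_sum_PiE) auto
    also have "\<dots> = (\<Sum>f\<in>?F. \<Prod>i\<in>{0..<n}. (x i * a (\<sigma> i)) ^ fibre_card N f i)"
      by (intro sum.cong refl prod_eq_prod_power_fibre_card)
    finally show ?thesis by (simp add: power_mult_distrib prod.distrib)
  qed
  then have "(\<Sum>\<sigma> | \<sigma> permutes {0..<n}. sign \<sigma> * (\<Sum>i\<in>{0..<n}. x i * a (\<sigma> i)) ^ N)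
    = (\<Sum>\<sigma> | \<sigma> permutes {0..<n}. \<Sum>f\<in>?F. (\<Prod>i\<in>{0..<n}. x i ^ fibre_card N f i)
        * (sign \<sigma> * (\<Prod>i\<in>{0..<n}. a (\<sigma> i) ^ fibre_card N f i)))"
    by (simp add: sum_distrib_left mult_ac)
  also have "\<dots> = (\<Sum>f\<in>?F. \<Sum>\<sigma> | \<sigma> permutes {0..<n}. (\<Prod>i\<in>{0..<n}. x i ^ fibre_card N f i)
        * (sign \<sigma> * (\<Prod>i\<in>{0..<n}. a (\<sigma> i) ^ fibre_card N f i)))"
    by (rule sum.swap)
  finally show ?thesis
    by (simp only: sum_distrib_left[symmetric] alternating_sum_eq_det)
qed

text \<open>A nonzero determinant needs \<open>n\<close> distinct exponents, whose sum is at least 0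
  + 1 + ... + (n - 1), but the exponents sum to \<open>N\<close>.\<close>

lemma alternating_power_sum_eq_0:
  fixes a x :: "nat \<Rightarrow> int"
  assumes "N < \<Sum>{0..<n}"
  shows "(\<Sum>\<sigma> | \<sigma> permutes {0..<n}. sign \<sigma> * (\<Sum>i\<in>{0..<n}. x i * a (\<sigma> i)) ^ N) = 0"
proof -
  have "\<not> inj_on (fibre_card N f) {0..<n}" if "f \<in> {0..<N} \<rightarrow>\<^sub>E {0..<n}" for f
  proof
    assume inj: "inj_on (fibre_card N f) {0..<n}"
    then have "\<Sum>{0..<n} \<le> \<Sum>(fibre_card N f ` {0..<n})"
      using sum_initial_segment_le(1)[of "fibre_card N f ` {0..<n}"] by (simp add: card_image)
    with inj sum_fibre_card[OF that] assms show False by (simp add: sum.reindex)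
  qed
  then show ?thesis
    unfolding alternating_power_sum_expand
    by (intro sum.neutral ballI) (simp add: det_generalized_vandermonde_eq_0)
qed

text \<open>Composing \<open>f\<close> with an inverse permutation relabels its fibres injectively.
  This gives an inequality, used for \<tau> and for its inverse.\<close>

lemma card_fibre_card_eq_permutation:
  assumes \<tau>: "\<tau> permutes {0..<n}"
  shows "card {f \<in> {0..<N} \<rightarrow>\<^sub>E {0..<n}. \<forall>i<n. fibre_card N f i = \<tau> i}
    = card {f \<in> {0..<N} \<rightarrow>\<^sub>E {0..<n}. \<forall>i<n. fibre_card N f i = i}"
proof -
  have le: "card {f \<in> {0..<N} \<rightarrow>\<^sub>E {0..<n}. \<forall>i<n. fibre_card N f i = q i}
      \<le> card {f \<in> {0..<N} \<rightarrow>\<^sub>E {0..<n}. \<forall>i<n. fibre_card N f i = q (p i)}"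
    if p: "p permutes {0..<n}" for p q :: "nat \<Rightarrow> nat"
  proof (rule card_inj_on_le)
    let ?h = "\<lambda>f. restrict (inv_into UNIV p \<circ> f) {0..<N}"
    have invp: "inv_into UNIV p permutes {0..<n}" using p by (rule permutes_inv)
    show "inj_on ?h {f \<in> {0..<N} \<rightarrow>\<^sub>E {0..<n}. \<forall>i<n. fibre_card N f i = q i}"
    proof (rule inj_onI)
      fix f g assume fg: "f \<in> {f \<in> {0..<N} \<rightarrow>\<^sub>E {0..<n}. \<forall>i<n. fibre_card N f i = q i}"
        "g \<in> {f \<in> {0..<N} \<rightarrow>\<^sub>E {0..<n}. \<forall>i<n. fibre_card N f i = q i}" "?h f = ?h g"
      have "f r = g r" if r: "r \<in> {0..<N}" for r
      proof -
        have "inv_into UNIV p (f r) = inv_into UNIV p (g r)"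
          using fun_cong[OF fg(3), of r] r by simp
        then show ?thesis by (rule injD[OF permutes_inj[OF invp]])
      qed
      moreover have "f \<in> {0..<N} \<rightarrow>\<^sub>E {0..<n}" "g \<in> {0..<N} \<rightarrow>\<^sub>E {0..<n}"
        using fg(1,2) by blast+
      ultimately show "f = g" by (intro PiE_ext)
    qed
    show "?h ` {f \<in> {0..<N} \<rightarrow>\<^sub>E {0..<n}. \<forall>i<n. fibre_card N f i = q i}
        \<subseteq> {f \<in> {0..<N} \<rightarrow>\<^sub>E {0..<n}. \<forall>i<n. fibre_card N f i = q (p i)}"
    proof (rule image_subsetI, intro CollectI conjI allI impI)
      fix f assume "f \<in> {f \<in> {0..<N} \<rightarrow>\<^sub>E {0..<n}. \<forall>i<n. fibre_card N f i = q i}"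
      then have f: "f \<in> {0..<N} \<rightarrow>\<^sub>E {0..<n}" "\<forall>i<n. fibre_card N f i = q i" by auto
      show "?h f \<in> {0..<N} \<rightarrow>\<^sub>E {0..<n}"
        unfolding restrict_PiE_iff o_apply permutes_in_image[OF invp] using PiE_mem[OF f(1)] by blast
      fix i assume i: "i < n"
      have "{r \<in> {0..<N}. ?h f r = i} = {r \<in> {0..<N}. f r = p i}"
        by (auto simp: permutes_inv_eq[OF p])
      then have "fibre_card N (?h f) i = fibre_card N f (p i)"
        unfolding fibre_card_def by (simp only:)
      moreover have "p i < n"
        using i permutes_in_image[OF p, of i] by simp
      ultimately show "fibre_card N (?h f) i = q (p i)"
        using f(2) by (simp only:)
    qed
  qed (rule finite_subset[OF Collect_restrict], simp add: finite_PiE)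
  show ?thesis
    using le[OF permutes_inv[OF \<tau>], of \<tau>] le[OF \<tau>, of "\<lambda>i. i"]
    unfolding permutes_inverses(1)[OF \<tau>] by (rule antisym)
qed

text \<open>The pairs (j, i) with i < j < n number \<open>N\<close>, and the first coordinate takes
  each value j exactly j times.\<close>

lemma exists_fibre_card_eq_identity:
  assumes N: "N = \<Sum>{0..<n}"
  shows "\<exists>f \<in> {0..<N} \<rightarrow>\<^sub>E {0..<n}. \<forall>i<n. fibre_card N f i = i"
proof -
  let ?P = "SIGMA j:{0..<n}. {0..<j}"
  have "card ?P = N" unfolding N by (subst card_SigmaI) simp_all
  then obtain b where b: "bij_betw b {0..<N} ?P"
    using ex_bij_betw_nat_finite[of ?P] by auto
  have bP: "fst (b r) < n" "snd (b r) < fst (b r)" if "r < N" for r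
    using bij_betw_apply[OF b, of r] that by (cases "b r", simp)+
  have img: "b ` {r \<in> {0..<N}. b r \<in> Q} = Q" if "Q \<subseteq> b ` {0..<N}" for Q
    using that by blast
  let ?f = "restrict (fst \<circ> b) {0..<N}"
  have "fibre_card N ?f i = i" if "i < n" for i
  proof -
    have eq: "{r \<in> {0..<N}. ?f r = i} = {r \<in> {0..<N}. b r \<in> {i} \<times> {0..<i}}"
    proof (rule Collect_cong)
      fix r
      show "(r \<in> {0..<N} \<and> ?f r = i) = (r \<in> {0..<N} \<and> b r \<in> {i} \<times> {0..<i})"
        using bP(2)[of r] by (cases "b r") auto
    qed
    have "{i} \<times> {0..<i} \<subseteq> ?P" using that by auto
    also have "?P = b ` {0..<N}" using bij_betw_imp_surj_on[OF b] ..
    finally have "b ` {r \<in> {0..<N}. b r \<in> {i} \<times> {0..<i}} = {i} \<times> {0..<i}"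
      by (rule img)
    then have "bij_betw b {r \<in> {0..<N}. b r \<in> {i} \<times> {0..<i}} ({i} \<times> {0..<i})"
      by (intro bij_betw_subset[OF b] Collect_restrict)
    from bij_betw_same_card[OF this] show ?thesis
      unfolding fibre_card_def eq by simp
  qed
  moreover have "?f \<in> {0..<N} \<rightarrow>\<^sub>E {0..<n}"
    unfolding restrict_PiE_iff using bP(1) by simp
  ultimately show ?thesis by (intro bexI[of _ ?f]) simp_all
qed

text \<open>In the critical degree distinct exponents must permute 0, ..., n - 1. Each permutation
  \<tau> gives its sign times the Vandermonde determinant of \<open>a\<close>, and the signed
  monomials in \<open>x\<close> assemble to that of \<open>x\<close>. The constant counts the maps
  with prescribed fibre sizes.\<close>

lemma alternating_power_sum_top:
  obtains K :: int where "K > 0" and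
    "\<And>a x :: nat \<Rightarrow> int.
      (\<Sum>\<sigma> | \<sigma> permutes {0..<n}. sign \<sigma> * (\<Sum>i\<in>{0..<n}. x i * a (\<sigma> i)) ^ \<Sum>{0..<n})
      = K * (\<Prod>(j, i) \<in> (SIGMA j:{0..<n}. {0..<j}). a j - a i)
          * (\<Prod>(j, i) \<in> (SIGMA j:{0..<n}. {0..<j}). x j - x i)"
proof
  define N where "N = \<Sum>{0..<n}"
  let ?F = "{0..<N} \<rightarrow>\<^sub>E {0..<n}"
  let ?K = "card {f \<in> ?F. \<forall>i<n. fibre_card N f i = i}"
  have fin: "finite ?F" by (intro finite_PiE) auto
  have "{f \<in> ?F. \<forall>i<n. fibre_card N f i = i} \<noteq> {}"
    using exists_fibre_card_eq_identity[OF N_def] by blast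
  then show "int ?K > 0" using fin by (simp add: card_gt_0_iff)
  fix a x :: "nat \<Rightarrow> int"
  define h where "h d = (\<Prod>i\<in>{0..<n}. x i ^ d i) * det (mat n n (\<lambda>(i, j). a j ^ d i))" for d
  define G where "G = {f \<in> ?F. inj_on (fibre_card N f) {0..<n}}"
  \<comment> \<open>The exponents extended by the identity, since \<open>permutes\<close> requires
    fixed points outside the range.\<close>
  define \<pi> where "\<pi> f i = (if i < n then fibre_card N f i else i)" for f i
  have h_cong: "h d = h d'" if "\<And>i. i < n \<Longrightarrow> d i = d' i" for d d'
  proof -
    have "mat n n (\<lambda>(i, j). a j ^ d i) = mat n n (\<lambda>(i, j). a j ^ d' i)"
      using that by (intro eq_matI) auto
    then show ?thesis using that by (simp add: h_def)
  qed
  have \<pi>: "\<pi> f permutes {0..<n}" if "f \<in> G" for f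
  proof -
    let ?D = "fibre_card N f ` {0..<n}"
    from that have inj: "inj_on (fibre_card N f) {0..<n}" and "f \<in> ?F" by (auto simp: G_def)
    then have "\<Sum>?D = \<Sum>{0..<card ?D}" "card ?D = n"
      using sum_fibre_card[of f N n] by (simp_all add: sum.reindex card_image N_def)
    then have "?D = {0..<n}" using sum_initial_segment_le(2)[of ?D] by simp
    with inj have "bij_betw (fibre_card N f) {0..<n} {0..<n}" by (simp add: bij_betw_def)
    then have "bij_betw (\<pi> f) {0..<n} {0..<n}"
      by (rule iffD1[OF bij_betw_cong, rotated]) (simp add: \<pi>_def)
    then show ?thesis by (rule bij_imp_permutes) (simp add: \<pi>_def)
  qed
  have fib: "{f \<in> G. \<pi> f = \<tau>} = {f \<in> ?F. \<forall>i<n. fibre_card N f i = \<tau> i}"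
    if \<tau>: "\<tau> permutes {0..<n}" for \<tau>
  proof (intro equalityI subsetI)
    fix f assume f: "f \<in> {f \<in> ?F. \<forall>i<n. fibre_card N f i = \<tau> i}"
    then have "inj_on (fibre_card N f) {0..<n}"
      using permutes_inj_on[OF \<tau>, of "{0..<n}"] by (auto simp: inj_on_def)
    moreover have "\<pi> f = \<tau>"
      using f permutes_not_in[OF \<tau>] by (auto simp: \<pi>_def)
    ultimately show "f \<in> {f \<in> G. \<pi> f = \<tau>}" using f by (auto simp: G_def)
  qed (auto simp: G_def \<pi>_def)
  have hperm: "h \<tau> = sign \<tau> * (\<Prod>i\<in>{0..<n}. x i ^ \<tau> i) * det (mat n n (\<lambda>(i, j). a j ^ i))"
    if \<tau>: "\<tau> permutes {0..<n}" for \<tau>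
  proof -
    have "mat n n (\<lambda>(i, j). mat n n (\<lambda>(i, j). a j ^ i) $$ (\<tau> i, j)) = mat n n (\<lambda>(i, j). a j ^ \<tau> i)"
      using permutes_in_image[OF \<tau>] by (intro eq_matI) auto
    then have "det (mat n n (\<lambda>(i, j). a j ^ \<tau> i)) = sign \<tau> * det (mat n n (\<lambda>(i, j). a j ^ i))"
      using det_permute_rows[OF _ \<tau>, of "mat n n (\<lambda>(i, j). a j ^ i)"] by simp
    then show ?thesis by (simp add: h_def)
  qed
  have "(\<Sum>\<sigma> | \<sigma> permutes {0..<n}. sign \<sigma> * (\<Sum>i\<in>{0..<n}. x i * a (\<sigma> i)) ^ N)
      = (\<Sum>f\<in>?F. h (fibre_card N f))"
    unfolding alternating_power_sum_expand h_def ..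
  also have "\<dots> = (\<Sum>f\<in>G. h (fibre_card N f))"
    using fin by (intro sum.mono_neutral_right)
      (auto simp: G_def h_def det_generalized_vandermonde_eq_0)
  also have "\<dots> = (\<Sum>f\<in>G. h (\<pi> f))"
    by (intro sum.cong refl h_cong) (simp add: \<pi>_def)
  also have "\<dots> = (\<Sum>\<tau> | \<tau> permutes {0..<n}. \<Sum>f | f \<in> G \<and> \<pi> f = \<tau>. h (\<pi> f))"
    using fin \<pi> by (intro sum.group[symmetric]) (auto simp: G_def finite_permutations)
  also have "\<dots> = (\<Sum>\<tau> | \<tau> permutes {0..<n}. int ?K * h \<tau>)"
  proof (intro sum.cong refl)
    fix \<tau> assume "\<tau> \<in> {\<tau>. \<tau> permutes {0..<n}}"
    then have \<tau>: "\<tau> permutes {0..<n}" by simp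
    have "(\<Sum>f | f \<in> G \<and> \<pi> f = \<tau>. h (\<pi> f)) = (\<Sum>f | f \<in> G \<and> \<pi> f = \<tau>. h \<tau>)"
      by (intro sum.cong) auto
    also have "\<dots> = int (card {f \<in> G. \<pi> f = \<tau>}) * h \<tau>" by simp
    also have "card {f \<in> G. \<pi> f = \<tau>} = ?K"
      unfolding fib[OF \<tau>] by (rule card_fibre_card_eq_permutation[OF \<tau>])
    finally show "(\<Sum>f | f \<in> G \<and> \<pi> f = \<tau>. h (\<pi> f)) = int ?K * h \<tau>" .
  qed
  also have "\<dots> = int ?K * (det (mat n n (\<lambda>(i, j). a j ^ i))
      * (\<Sum>\<tau> | \<tau> permutes {0..<n}. sign \<tau> * (\<Prod>i\<in>{0..<n}. x i ^ \<tau> i)))"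
    by (simp add: sum_distrib_left hperm mult_ac)
  also have "(\<Sum>\<tau> | \<tau> permutes {0..<n}. sign \<tau> * (\<Prod>i\<in>{0..<n}. x i ^ \<tau> i))
      = det (mat n n (\<lambda>(i, j). x i ^ j))"
    by (subst det_def'[of _ n])
       (auto intro!: sum.cong prod.cong simp: permutes_in_image[of _ "{0..<n}", simplified])
  finally show "(\<Sum>\<sigma> | \<sigma> permutes {0..<n}. sign \<sigma> * (\<Sum>i\<in>{0..<n}. x i * a (\<sigma> i)) ^ \<Sum>{0..<n})
      = int ?K * (\<Prod>(j, i) \<in> (SIGMA j:{0..<n}. {0..<j}). a j - a i)
          * (\<Prod>(j, i) \<in> (SIGMA j:{0..<n}. {0..<j}). x j - x i)"
    unfolding N_def det_vandermonde det_vandermonde_transposed by (simp only: mult.assoc)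
qed

text \<open>Polarization of each summand; the factorial stays on the left so that no division in the
  integers is needed.\<close>

lemma fact_mult_alternating_prod_sum:
  fixes a x :: "nat \<Rightarrow> int" and vs :: "(nat \<Rightarrow> int) list"
  shows "fact (length vs)
      * (\<Sum>\<sigma> | \<sigma> permutes {0..<n}. sign \<sigma> * (\<Prod>v\<leftarrow>vs. \<Sum>i\<in>{0..<n}. v i * a (\<sigma> i)))
    = iter_diff vs (\<lambda>x. \<Sum>\<sigma> | \<sigma> permutes {0..<n}.
        sign \<sigma> * (\<Sum>i\<in>{0..<n}. x i * a (\<sigma> i)) ^ length vs) x"
proof -
  have "iter_diff vs (\<lambda>x. (\<Sum>i\<in>{0..<n}. x i * a (\<sigma> i)) ^ length vs) x
      = fact (length vs) * (\<Prod>v\<leftarrow>vs. \<Sum>i\<in>{0..<n}. v i * a (\<sigma> i))" for \<sigma>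
    by (subst iter_diff_power) (simp_all add: plus_fun_def distrib_right sum.distrib)
  then show ?thesis
    by (simp add: iter_diff_sum sum_distrib_left mult_ac)
qed

section \<open>Avoiding orders\<close>

lemma exists_order_avoiding_even:
  fixes a :: "nat \<Rightarrow> int"
  assumes inj: "inj_on a {0..<2 * m}" and M: "finite M" "card M \<le> m"
  shows "\<exists>\<sigma>. \<sigma> permutes {0..<2 * m} \<and>
    (\<forall>k. 1 \<le> k \<and> k < 2 * m \<longrightarrow> (\<Sum>i\<in>{0..<k}. a (\<sigma> i)) \<notin> M)"
proof (rule ccontr)
  assume neg: "\<not> ?thesis"
  define n where "n = 2 * m"
  define P where "P = (SIGMA j:{0..<n}. {0..<j})"
  \<comment> \<open>A pair at distance \<open>l \<le> m\<close> takes the left end of its interval \<open>{i<..j}\<close>, any other the right end.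
    Distances \<open>l\<close> and \<open>n + 1 - l\<close> together use each \<open>k\<close> once (distance \<open>1\<close> does so alone) and share
    the index \<open>c = l - 1\<close> of a forbidden value.\<close>
  define h where "h = (\<lambda>(j, i). if j - i \<le> m then i + 1 else j)"
  define c where "c = (\<lambda>(j, i). if j - i \<le> m then j - i - 1 else n - (j - i))"
  \<comment> \<open>With this sign \<open>x j - x i\<close> for i < j is never negative at
    \<open>w p\<close>, and \<open>L\<close> becomes minus a partial sum.\<close>
  define w :: "nat \<times> nat \<Rightarrow> nat \<Rightarrow> int" where "w p = (\<lambda>r. if r < h p then -1 else 0)" for p
  define L where "L \<sigma> p = (\<Sum>i\<in>{0..<n}. w p i * a (\<sigma> i))" for \<sigma> p
  define W where "W B = (\<Sum>\<sigma> | \<sigma> permutes {0..<n}. sign \<sigma> * (\<Prod>p\<in>B. L \<sigma> p))" for B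
  have finP: "finite P" by (simp add: P_def)
  have cardP: "card P = \<Sum>{0..<n}" unfolding P_def by (subst card_SigmaI) simp_all
  have h: "i < h (j, i)" "h (j, i) \<le> j" if "(j, i) \<in> P" for i j
    using that by (auto simp: P_def h_def)
  \<comment> \<open>Every partial sum must meet every forbidden value in some factor. The short pair
    for index \<open>q\<close> has distance q + 1; if it would overrun \<open>n\<close>, the long
    pair of distance n - q takes its place.\<close>
  have hits: "\<exists>p\<in>P. h p = k \<and> c p = q" if "1 \<le> k" "k < n" "q < m" for k q
  proof (cases "k + q < n")
    case True
    have "k + q - (k - 1) = q + 1" using that by simp
    then have "h (k + q, k - 1) = k" "c (k + q, k - 1) = q"
      using that by (simp_all add: h_def c_def)
    moreover have "(k + q, k - 1) \<in> P" using that True by (simp add: P_def)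
    ultimately show ?thesis by (intro bexI[of _ "(k + q, k - 1)"] conjI)
  next
    case False
    have "k - (k - (n - q)) = n - q" using that False by simp
    moreover have "\<not> n - q \<le> m" "n - (n - q) = q" using that by (simp_all add: n_def)
    ultimately have "h (k, k - (n - q)) = k" "c (k, k - (n - q)) = q"
      by (simp_all add: h_def c_def)
    moreover have "(k, k - (n - q)) \<in> P" using that by (simp add: P_def n_def)
    ultimately show ?thesis by (intro bexI[of _ "(k, k - (n - q))"] conjI)
  qed
  have L_eq: "L \<sigma> p = - (\<Sum>i\<in>{0..<h p}. a (\<sigma> i))" if "p \<in> P" for \<sigma> p
  proof -
    obtain j i where p: "p = (j, i)" by (cases p)
    with that have "j < n" by (simp add: P_def)
    with h(2)[of j i] that have "h p \<le> n" by (simp add: p)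
    have "L \<sigma> p = (\<Sum>i\<in>{0..<n}. if i < h p then - a (\<sigma> i) else 0)"
      unfolding L_def w_def by (intro sum.cong) auto
    also have "\<dots> = (\<Sum>i\<in>{0..<h p}. - a (\<sigma> i))"
      using \<open>h p \<le> n\<close> by (intro sum.mono_neutral_cong_right) auto
    finally show ?thesis by (simp add: sum_negf)
  qed
  \<comment> \<open>If \<open>M\<close> has fewer than \<open>m\<close> elements, \<open>e\<close>
    is arbitrary at the remaining indices; one vanishing factor still kills the product.\<close>
  obtain e where e: "bij_betw e {0..<card M} M"
    using ex_bij_betw_nat_finite[OF M(1)] by blast
  have F0: "(\<Prod>p\<in>P. L \<sigma> p + e (c p)) = 0" if \<sigma>: "\<sigma> permutes {0..<n}" for \<sigma>
  proof -
    obtain k where k: "1 \<le> k" "k < n" "(\<Sum>i\<in>{0..<k}. a (\<sigma> i)) \<in> M"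
      using neg \<sigma> unfolding n_def by blast
    have "(\<Sum>i\<in>{0..<k}. a (\<sigma> i)) \<in> e ` {0..<card M}"
      using k(3) bij_betw_imp_surj_on[OF e] by simp
    then obtain q where q: "q < card M" "e q = (\<Sum>i\<in>{0..<k}. a (\<sigma> i))"
      by (elim imageE) simp
    have "q < m" using q(1) M(2) by simp
    with hits[OF k(1,2)] obtain p where p: "p \<in> P" "h p = k" "c p = q" by blast
    have "L \<sigma> p + e (c p) = 0" using q(2) by (simp add: L_eq[OF p(1)] p(2,3))
    then show ?thesis by (intro prod_zero[OF finP] bexI[OF _ p(1)])
  qed
  have W_list: "fact (length bs) * W (set bs) = iter_diff (map w bs) (\<lambda>x. \<Sum>\<sigma> | \<sigma> permutes {0..<n}.
      sign \<sigma> * (\<Sum>i\<in>{0..<n}. x i * a (\<sigma> i)) ^ length bs) 0" if "distinct bs" for bs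
  proof -
    have "W (set bs) = (\<Sum>\<sigma> | \<sigma> permutes {0..<n}.
        sign \<sigma> * (\<Prod>v\<leftarrow>map w bs. \<Sum>i\<in>{0..<n}. v i * a (\<sigma> i)))"
      unfolding W_def L_def prod.distinct_set_conv_list[OF that] map_map o_def ..
    then show ?thesis
      using fact_mult_alternating_prod_sum[of "map w bs" a n 0] unfolding length_map by (simp only:)
  qed
  \<comment> \<open>A proper subset of the factors has degree below that of the Vandermonde product,
    so every term that contains a forbidden value drops out.\<close>
  have W0: "W B = 0" if "B \<in> Pow P - {P}" for B
  proof -
    from that have B: "B \<subset> P" by blast
    then have "card B < \<Sum>{0..<n}"
      using psubset_card_mono[OF finP] cardP by metis
    moreover obtain bs where bs: "distinct bs" "set bs = B"
      using finite_distinct_list[of B] finite_subset[OF psubset_imp_subset[OF B] finP] by blast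
    ultimately have "length bs < \<Sum>{0..<n}" using distinct_card[OF bs(1)] by metis
    then show ?thesis
      using W_list[OF bs(1)] unfolding bs(2) alternating_power_sum_eq_0[OF \<open>length bs < _\<close>] iter_diff_zero
      by simp
  qed
  have "0 = (\<Sum>\<sigma> | \<sigma> permutes {0..<n}. sign \<sigma> * (\<Prod>p\<in>P. L \<sigma> p + e (c p)))"
    using F0 by (intro sum.neutral[symmetric]) simp
  also have "\<dots> = (\<Sum>\<sigma> | \<sigma> permutes {0..<n}. \<Sum>B\<in>Pow P.
      (\<Prod>p\<in>P - B. e (c p)) * (sign \<sigma> * (\<Prod>p\<in>B. L \<sigma> p)))"
    unfolding prod_add[OF finP] sum_distrib_left by (intro sum.cong refl) (simp only: mult_ac)
  also have "\<dots> = (\<Sum>B\<in>Pow P. (\<Prod>p\<in>P - B. e (c p)) * W B)"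
    unfolding W_def sum_distrib_left by (rule sum.swap)
  also have "\<dots> = (\<Sum>B\<in>{P}. (\<Prod>p\<in>P - B. e (c p)) * W B)"
    using finP W0 by (intro sum.mono_neutral_right) auto
  finally have WP: "W P = 0" by simp
  obtain K :: int where K: "K > 0" and top: "\<And>a x :: nat \<Rightarrow> int.
      (\<Sum>\<sigma> | \<sigma> permutes {0..<n}. sign \<sigma> * (\<Sum>i\<in>{0..<n}. x i * a (\<sigma> i)) ^ \<Sum>{0..<n})
      = K * (\<Prod>(j, i) \<in> P. a j - a i) * (\<Prod>(j, i) \<in> P. x j - x i)"
    by (rule alternating_power_sum_top[of n, folded P_def]) (rule that)
  obtain ss where ss: "distinct ss" "set ss = P"
    using finite_distinct_list[OF finP] by blast
  then have len: "length ss = \<Sum>{0..<n}" using cardP distinct_card by metis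
  have zero: "0 = K * (\<Prod>(j, i) \<in> P. a j - a i)
      * iter_diff (map w ss) (\<lambda>x. \<Prod>p \<in> set ss. (\<lambda>(j, i). x j - x i) p) 0"
    using W_list[OF ss(1)] unfolding len top iter_diff_scale ss(2) WP mult_zero_right .
  \<comment> \<open>Each pair is matched with its own vector: i < h (j, i) <= j makes the difference
    there equal to 1.\<close>
  have pos: "0 < iter_diff (map w ss) (\<lambda>x. \<Prod>p \<in> set ss. (\<lambda>(j, i). x j - x i) p) 0"
  proof (rule iter_diff_prod_pos[OF ss(1)])
    fix s t assume "s \<in> set ss" "t \<in> set ss"
    then show "0 \<le> (\<lambda>(j, i). w t j - w t i) s"
      unfolding ss(2) by (auto simp: w_def P_def)
  next
    fix s assume s: "s \<in> set ss"
    obtain j i where ji: "s = (j, i)" by (cases s)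
    then have "(j, i) \<in> P" using s ss(2) by simp
    from h[OF this] show "0 < (\<lambda>(j, i). w s j - w s i) s"
      by (simp add: ji w_def)
  qed auto
  have nonzero: "(\<Prod>(j, i) \<in> P. a j - a i) \<noteq> 0"
  proof
    assume "(\<Prod>(j, i) \<in> P. a j - a i) = 0"
    then obtain p where p: "p \<in> P" "(case p of (j, i) \<Rightarrow> a j - a i) = 0"
      unfolding prod_zero_iff[OF finP] by (elim bexE)
    obtain j i where ji: "p = (j, i)" by (cases p)
    from p have "i < j" "j < n" "a j = a i" by (simp_all add: ji P_def)
    with inj_onD[OF inj, of j i] show False by (simp add: n_def)
  qed
  have "K * x * y \<noteq> 0" if "x \<noteq> 0" "0 < y" for x y
    using that K by simp
  from this[OF nonzero pos] zero[symmetric] show False by (rule notE)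
qed

section \<open>Lists of jumps: odd length, nonzero jumps, and the return to permutations\<close>

definition avoiding_order :: "int set \<Rightarrow> int list \<Rightarrow> bool" where
  "avoiding_order M bs \<longleftrightarrow> (\<forall>k. 1 \<le> k \<and> k < length bs \<longrightarrow> sum_list (take k bs) \<notin> M)"

lemma exists_avoiding_order_even:
  assumes A: "finite A" "even (card A)" and M: "finite M" "card M \<le> card A div 2"
  shows "\<exists>bs. distinct bs \<and> set bs = A \<and> avoiding_order M bs"
proof -
  define m where "m = card A div 2"
  have card: "card A = 2 * m" using A(2) by (simp add: m_def)
  obtain a where a: "bij_betw a {0..<2 * m} A"
    using ex_bij_betw_nat_finite[OF A(1)] card by auto
  obtain \<sigma> where \<sigma>: "\<sigma> permutes {0..<2 * m}"
    and avoid: "\<And>k. 1 \<le> k \<Longrightarrow> k < 2 * m \<Longrightarrow> (\<Sum>i\<in>{0..<k}. a (\<sigma> i)) \<notin> M"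
    using exists_order_avoiding_even[OF bij_betw_imp_inj_on[OF a] M(1)] M(2) m_def by blast
  have bij: "bij_betw (a \<circ> \<sigma>) {0..<2 * m} A"
    using bij_betw_trans[OF permutes_imp_bij[OF \<sigma>] a] .
  let ?bs = "map (a \<circ> \<sigma>) [0..<2 * m]"
  have "distinct ?bs" using bij by (simp add: distinct_map bij_betw_def)
  moreover have "set ?bs = A" using bij by (simp add: bij_betw_def)
  moreover have "sum_list (take k ?bs) = (\<Sum>i\<in>{0..<k}. a (\<sigma> i))" if "k < 2 * m" for k
    using that by (simp add: take_map sum_list_distinct_conv_sum_set)
  ultimately show ?thesis
    using avoid by (intro exI[of _ ?bs]) (auto simp: avoiding_order_def)
qed

lemma exists_avoiding_order:
  assumes A: "finite A" and M: "finite M" "card M \<le> card A div 2"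
  shows "\<exists>bs. distinct bs \<and> set bs = A \<and> avoiding_order M bs"
proof (cases "even (card A)")
  case False
  \<comment> \<open>Pigeonhole: the sums with one jump left out are \<open>card A\<close> distinct
    values, too many to lie all in \<open>M\<close>.\<close>
  then have "card M < card A" using M(2) by presburger
  moreover have "card ((\<lambda>z. \<Sum>A - z) ` A) = card A"
    by (intro card_image inj_onI) simp
  ultimately have "\<not> (\<lambda>z. \<Sum>A - z) ` A \<subseteq> M"
    using card_mono[OF M(1), of "(\<lambda>z. \<Sum>A - z) ` A"] by linarith
  then obtain z where z: "z \<in> A" "\<Sum>A - z \<notin> M" by blast
  have "card (A - {z}) = card A - 1" using z A by simp
  \<comment> \<open>As \<open>card A\<close> is odd, removing one element does not change the half
    rounded down.\<close>
  then have "even (card (A - {z}))" "card M \<le> card (A - {z}) div 2"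
    using False M(2) by presburger+
  then obtain bs where bs: "distinct bs" "set bs = A - {z}" "avoiding_order M bs"
    using exists_avoiding_order_even[of "A - {z}" M] A M(1) by blast
  have "sum_list bs = \<Sum>A - z"
    using bs(1,2) z(1) A by (simp add: sum_list_distinct_conv_sum_set[of bs "\<lambda>x. x", simplified] sum_diff1)
  then have "sum_list (take k (bs @ [z])) \<notin> M" if "1 \<le> k" "k < length (bs @ [z])" for k
    using that bs(3) z(2) unfolding avoiding_order_def by (cases "k = length bs") simp_all
  then have "avoiding_order M (bs @ [z])"
    unfolding avoiding_order_def by blast
  then show ?thesis using bs z by (intro exI[of _ "bs @ [z]"]) auto
qed (use exists_avoiding_order_even assms in blast)

text \<open>Inserting 0 raises the admissible size of \<open>M\<close> to half of
  \<open>card A + 1\<close>. After its deletion each proper prefix sum is still a proper prefix sum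
  of the longer list, whose prefix is one longer once it passes the 0.\<close>

lemma exists_avoiding_order_nonzero:
  assumes A: "finite A" "0 \<notin> A" and M: "finite M" "card M \<le> (card A + 1) div 2"
  shows "\<exists>bs. distinct bs \<and> set bs = A \<and> avoiding_order M bs"
proof -
  obtain bs where bs: "distinct bs" "set bs = insert 0 A" "avoiding_order M bs"
    using exists_avoiding_order[of "insert 0 A" M] A M by auto
  then obtain us vs where split: "bs = us @ 0 # vs"
    using split_list[of 0 bs] by auto
  have "avoiding_order M (us @ vs)"
    unfolding avoiding_order_def
  proof (intro allI impI)
    fix k assume k: "1 \<le> k \<and> k < length (us @ vs)"
    show "sum_list (take k (us @ vs)) \<notin> M"
    proof (cases "k \<le> length us")
      case True
      then have "take k (us @ vs) = take k bs" by (simp add: split)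
      with k bs(3) show ?thesis by (simp add: avoiding_order_def split)
    next
      case False
      then have "sum_list (take k (us @ vs)) = sum_list (take (Suc k) bs)"
        by (simp add: split Suc_diff_le)
      with k bs(3) show ?thesis by (simp add: avoiding_order_def split)
    qed
  qed
  moreover have "distinct (us @ vs)" using bs(1) by (auto simp: split)
  moreover have "set (us @ vs) = A"
  proof -
    have "set (us @ vs) = set bs - {0}" using bs(1) by (auto simp: split)
    then show ?thesis using bs(2) A(2) by simp
  qed
  ultimately show ?thesis by blast
qed

lemma avoiding_order_imp_permutation:
  fixes a :: "nat \<Rightarrow> int"
  assumes inj: "inj_on a {1..n}"
    and bs: "distinct bs" "set bs = a ` {1..n}" "avoiding_order M bs"
  shows "\<exists>\<sigma>. \<sigma> permutes {1..n} \<and>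
    (\<forall>k. 1 \<le> k \<and> k < n \<longrightarrow> (\<Sum>i=1..k. a (\<sigma> i)) \<notin> M)"
proof -
  have len: "length bs = n"
    using distinct_card[OF bs(1)] unfolding bs(2) card_image[OF inj] by simp
  \<comment> \<open>Lists are indexed from 0 and the jumps from 1, hence the shift.\<close>
  define \<sigma> where "\<sigma> i = (if i \<in> {1..n} then inv_into {1..n} a (bs ! (i - 1)) else i)" for i
  have "bij_betw (\<lambda>i. i - 1) {1..n} {..<length bs}"
    unfolding len by (rule bij_betwI[where g = Suc]) auto
  then have "bij_betw (\<lambda>i. bs ! (i - 1)) {1..n} (a ` {1..n})"
    using bij_betw_trans[OF _ bij_betw_nth[OF bs(1) refl bs(2)[symmetric]]] by (simp add: o_def)
  then have "bij_betw (\<lambda>i. inv_into {1..n} a (bs ! (i - 1))) {1..n} {1..n}"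
    using bij_betw_trans[OF _ bij_betw_inv_into[OF inj_on_imp_bij_betw[OF inj]]] by (simp add: o_def)
  then have "bij_betw \<sigma> {1..n} {1..n}"
    by (rule iffD1[OF bij_betw_cong, rotated]) (simp add: \<sigma>_def)
  then have "\<sigma> permutes {1..n}"
    by (rule bij_imp_permutes) (auto simp: \<sigma>_def)
  moreover have "(\<Sum>i=1..k. a (\<sigma> i)) = sum_list (take k bs)" if "k < n" for k
  proof -
    have "a (\<sigma> i) = bs ! (i - 1)" if "i \<in> {1..n}" for i
    proof -
      have "bs ! (i - 1) \<in> a ` {1..n}"
        using that len bs(2) nth_mem[of "i - 1" bs] by auto
      with that show ?thesis by (simp add: \<sigma>_def f_inv_into_f)
    qed
    then have "(\<Sum>i=1..k. a (\<sigma> i)) = (\<Sum>i=1..k. bs ! (i - 1))"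
      using that by (intro sum.cong) auto
    also have "\<dots> = (\<Sum>i\<in>{0..<k}. bs ! i)"
      by (rule sum.reindex_bij_witness[where i = Suc and j = "\<lambda>i. i - 1"]) auto
    finally show ?thesis using that len by (simp add: sum_list_sum_nth)
  qed
  ultimately show ?thesis
    using bs(3) len by (auto simp: avoiding_order_def)
qed

theorem theorem1:
  fixes n :: nat and a :: "nat \<Rightarrow> int" and M :: "int set"
  assumes "n \<ge> 1"
    and "inj_on a {1..n}"
    and "finite M"
  shows "(card M \<le> n div 2 \<longrightarrow>
            (\<exists>\<sigma>. \<sigma> permutes {1..n} \<and>
                 (\<forall>k. 1 \<le> k \<and> k < n \<longrightarrow> (\<Sum>i=1..k. a (\<sigma> i)) \<notin> M)))
       \<and> ((\<forall>i\<in>{1..n}. a i \<noteq> 0) \<and> card M \<le> (n + 1) div 2 \<longrightarrow>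
            (\<exists>\<sigma>. \<sigma> permutes {1..n} \<and>
                 (\<forall>k. 1 \<le> k \<and> k < n \<longrightarrow> (\<Sum>i=1..k. a (\<sigma> i)) \<notin> M)))"
proof (intro conjI impI)
  have card: "card (a ` {1..n}) = n" using assms(2) by (simp add: card_image)
  assume "card M \<le> n div 2"
  then obtain bs where "distinct bs" "set bs = a ` {1..n}" "avoiding_order M bs"
    using exists_avoiding_order[of "a ` {1..n}" M] assms(3) card by auto
  then show "\<exists>\<sigma>. \<sigma> permutes {1..n} \<and> (\<forall>k. 1 \<le> k \<and> k < n \<longrightarrow> (\<Sum>i=1..k. a (\<sigma> i)) \<notin> M)"
    by (rule avoiding_order_imp_permutation[OF assms(2)])
next
  have card: "card (a ` {1..n}) = n" using assms(2) by (simp add: card_image)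
  assume "(\<forall>i\<in>{1..n}. a i \<noteq> 0) \<and> card M \<le> (n + 1) div 2"
  moreover from this have "0 \<notin> a ` {1..n}" by auto
  ultimately obtain bs where "distinct bs" "set bs = a ` {1..n}" "avoiding_order M bs"
    using exists_avoiding_order_nonzero[of "a ` {1..n}" M] assms(3) card by auto
  then show "\<exists>\<sigma>. \<sigma> permutes {1..n} \<and> (\<forall>k. 1 \<le> k \<and> k < n \<longrightarrow> (\<Sum>i=1..k. a (\<sigma> i)) \<notin> M)"
    by (rule avoiding_order_imp_permutation[OF assms(2)])
qed

end
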